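(* Let $p=(12,R)$ be a mesh pattern where $R$ is any one of the following eight sets of shaded cells: $\{(0,2),(1,2),(2,2),(1,1),(0,0)\}$, $\{(0,2),(2,2),(0,1),(1,1),(0,0)\}$, $\{(2,2),(1,1),(2,1),(0,0),(2,0)\}$, $\{(2,2),(1,1),(0,0),(1,0),(2,0)\}$, $\{(0,2),(1,2),(0,1),(2,1),(0,0)\}$, $\{(0,2),(1,2),(2,2),(0,1),(1,0)\}$, $\{(2,2),(0,1),(2,1),(1,0),(2,0)\}$, $\{(1,2),(2,1),(0,0),(1,0),(2,0)\}$. Then $A(t)=F(t,0)$ and, for every $n\ge 1$, $$[t^n]F(t,q)=\sum_{m=0}^{n-1}\frac{(n-1)!}{m!}\,T_m,\qquad\text{where } T_m:=T_m(q)=[t^m]\frac{F(t)}{1+t(1-q)F(t)}.$$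
   Context: $\mathfrak S_n$ is the set of permutations of $\{1,\dots,n\}$ in one-line notation $\sigma=\sigma_1\cdots\sigma_n$. For $R\subseteq\{0,1,2\}^2$, an occurrence of the mesh pattern $(12,R)$ in $\sigma\in\mathfrak S_n$ is a pair of positions $i_1<i_2$ with $\sigma_{i_1}<\sigma_{i_2}$ such that, setting $i_0=0$, $i_3=n+1$, $v_0=0$, $v_1=\sigma_{i_1}$, $v_2=\sigma_{i_2}$, $v_3=n+1$, for every $(x,y)\in R$ there is no index $\ell$ with $i_x<\ell<i_{x+1}$ and $v_y<\sigma_\ell<v_{y+1}$. Let $s_{n,k}(p)$ be the number of $\sigma\in\mathfrak S_n$ with exactly $k$ occurrences of $p$. All generating functions are formal power series: $F(t,q)=\sum_{n,k\ge 0}s_{n,k}(p)q^kt^n$; $A(t)=\sum_{n\ge0}s_{n,0}(p)t^n$ is the generating function of permutations avoiding $p$; and $F(t)=F(t,1)=\sum_{n\ge 0}n!\,t^n$. $[t^m]G$ denotes the coefficient of $t^m$ in $G$. *)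

theory Defs
  imports
    "HOL-Combinatorics.Permutations"
    "HOL-Computational_Algebra.Formal_Power_Series"
begin

text \<open>
  The one-line notation \<open>\<sigma>\<^sub>1 \<dots> \<sigma>\<^sub>n\<close> of a permutation of \<open>{1..n}\<close> is a function \<open>\<sigma>\<close> with
  \<open>\<sigma> permutes {1..n}\<close>, read as \<open>\<sigma>\<^sub>i = \<sigma> i\<close>.
  The lists below are indexed from \<open>0\<close> and hold \<open>i\<^sub>0, \<dots>, i\<^sub>3\<close> and \<open>v\<^sub>0, \<dots>, v\<^sub>3\<close>; they are
  meaningful for shadings \<open>R \<subseteq> {0,1,2} \<times> {0,1,2}\<close>, where a cell \<open>(x, y)\<close> has column \<open>x\<close>
  and row \<open>y\<close>.
\<close>

definition mesh12_occurrence ::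
  "(nat \<times> nat) set \<Rightarrow> nat \<Rightarrow> (nat \<Rightarrow> nat) \<Rightarrow> nat \<Rightarrow> nat \<Rightarrow> bool" where
  "mesh12_occurrence R n \<sigma> i1 i2 \<longleftrightarrow>
     1 \<le> i1 \<and> i1 < i2 \<and> i2 \<le> n \<and> \<sigma> i1 < \<sigma> i2 \<and>
     (let i = [0, i1, i2, n + 1]; v = [0, \<sigma> i1, \<sigma> i2, n + 1] in
       \<forall>(x, y) \<in> R. \<not> (\<exists>l. i ! x < l \<and> l < i ! (x + 1) \<and> v ! y < \<sigma> l \<and> \<sigma> l < v ! (y + 1)))"

definition mesh12_occurrences ::
  "(nat \<times> nat) set \<Rightarrow> nat \<Rightarrow> (nat \<Rightarrow> nat) \<Rightarrow> (nat \<times> nat) set" where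
  "mesh12_occurrences R n \<sigma> = {(i1, i2). mesh12_occurrence R n \<sigma> i1 i2}"

definition mesh12_count :: "(nat \<times> nat) set \<Rightarrow> nat \<Rightarrow> nat \<Rightarrow> nat" where
  "mesh12_count R n k = card {\<sigma>. \<sigma> permutes {1..n} \<and> card (mesh12_occurrences R n \<sigma>) = k}"

text \<open>
  Formal power series in \<open>t\<close> and \<open>q\<close> are elements of \<open>rat fps fps\<close>: the outer variable is \<open>t\<close>,
  the inner one \<open>q\<close>.
\<close>

abbreviation var_t :: "rat fps fps" where
  "var_t \<equiv> fps_X"

abbreviation var_q :: "rat fps fps" where
  "var_q \<equiv> fps_const fps_X"

definition mesh12_gf :: "(nat \<times> nat) set \<Rightarrow> rat fps fps" where
  "mesh12_gf R = Abs_fps (\<lambda>n. Abs_fps (\<lambda>k. of_nat (mesh12_count R n k)))"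

definition mesh12_avoid_gf :: "(nat \<times> nat) set \<Rightarrow> rat fps" where
  "mesh12_avoid_gf R = Abs_fps (\<lambda>n. of_nat (mesh12_count R n 0))"

text \<open>\<open>G(t, 0)\<close>: the substitution \<open>q = 0\<close>, giving a power series in \<open>t\<close> alone.\<close>

definition subst_q0 :: "rat fps fps \<Rightarrow> rat fps" where
  "subst_q0 G = Abs_fps (\<lambda>n. fps_nth (fps_nth G n oo 0) 0)"

text \<open>
  \<open>F(t) = F(t, 1)\<close>. Each coefficient of \<open>F(t, q)\<close> in \<open>t\<close> is a polynomial in \<open>q\<close>, and its
  value at \<open>q = 1\<close> is \<open>n!\<close> for every shading; see \<open>mesh12_count_eq_0\<close> and
  \<open>mesh12_count_sum\<close> below.
\<close>

definition perm_gf :: "rat fps fps" where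
  "perm_gf = Abs_fps fact"

definition T_poly :: "nat \<Rightarrow> rat fps" where
  "T_poly m = fps_nth (perm_gf / (1 + var_t * (1 - var_q) * perm_gf)) m"

lemma card_mesh12_occurrences_le: "card (mesh12_occurrences R n \<sigma>) \<le> n * n"
proof -
  have "mesh12_occurrences R n \<sigma> \<subseteq> {1..n} \<times> {1..n}"
    by (auto simp: mesh12_occurrences_def mesh12_occurrence_def)
  from card_mono[OF _ this] show ?thesis
    by (simp add: card_cartesian_product)
qed

lemma mesh12_count_eq_0: "n * n < k \<Longrightarrow> mesh12_count R n k = 0"
proof -
  assume "n * n < k"
  then have "card (mesh12_occurrences R n \<sigma>) \<noteq> k" for \<sigma>
    using card_mesh12_occurrences_le[of R n \<sigma>] by simp
  then show ?thesis by (simp add: mesh12_count_def)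
qed

lemma mesh12_count_sum: "(\<Sum>k\<le>n * n. mesh12_count R n k) = fact n"
proof -
  let ?P = "{\<sigma>. \<sigma> permutes {1..n}}"
  have fin: "finite ?P" by (rule finite_permutations) simp
  have "(\<Sum>k\<le>n * n. mesh12_count R n k) =
          (\<Sum>k\<le>n * n. \<Sum>\<sigma> | \<sigma> \<in> ?P \<and> card (mesh12_occurrences R n \<sigma>) = k. 1)"
    by (simp add: mesh12_count_def)
  also have "\<dots> = (\<Sum>\<sigma>\<in>?P. 1)"
    by (rule sum.group) (use fin card_mesh12_occurrences_le in auto)
  also have "\<dots> = fact n"
    using card_permutations[of "{1..n}" n] by simp
  finally show ?thesis .
qed

text \<open>The quotient defining \<open>T_poly\<close> is the genuine one.\<close>

lemma T_poly_quotient: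
  "(perm_gf / (1 + var_t * (1 - var_q) * perm_gf)) * (1 + var_t * (1 - var_q) * perm_gf) = perm_gf"
proof -
  let ?g = "1 + var_t * (1 - var_q) * perm_gf"
  have g0: "fps_nth ?g 0 = 1" by (simp add: mult.assoc)
  have deg: "subdegree ?g = 0" by (rule subdegree_eq_0) (use g0 in simp)
  have inv: "?g * inverse ?g = 1"
    by (subst fps_inverse_def, rule fps_right_inverse) (use g0 in simp)
  have "perm_gf / ?g = perm_gf * inverse ?g"
    unfolding fps_divide_def fps_unit_factor_def deg by simp
  then have "perm_gf / ?g * ?g = perm_gf * (?g * inverse ?g)"
    by (simp only: mult_ac)
  then show ?thesis by (simp only: inv mult_1_right)
qed

end

theory Submission
  imports Defs "HOL-Combinatorics.Multiset_Permutations"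
begin

text \<open>
  Call an entry of a word a strong point if all earlier entries are smaller and all later ones
  larger (a strong fixed point, when the word is a permutation of \<open>{1..n}\<close>). The eight shadings
  form two orbits under inversion and reverse-complement of permutations, operations that map
  occurrences to occurrences of the transposed, respectively rotated, pattern. Each orbit
  contains one shading whose whole bottom row is shaded. That row forces the first
  entry of an occurrence to be the value \<open>1\<close>, and the other two cells then say that the second
  entry is a strong point of the word after \<open>1\<close> (cells \<open>(1,2)\<close>, \<open>(2,1)\<close>), or of the reversal of
  that word (cells \<open>(1,1)\<close>, \<open>(2,2)\<close>). So both representatives count the strong points of the part
  of a permutation after its minimum, up to a reversal that permutes the possible parts.

  The series \<open>F / (1 + t (1 - q) F)\<close> counts the arrangements of \<open>n\<close> letters
  by their number of strong points: mark a strong point and give it the weight \<open>1 - q\<close> times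
  \<open>q\<close> to the number of strong points before it. For a word with \<open>s\<close> strong points these weights
  add up to \<open>1 - q ^ s\<close>. On the other hand the part after a marked strong point is arbitrary and
  the part before it carries its own strong points, so the marked words on \<open>n\<close> letters contribute
  \<open>(1 - q) * (\<Sum>m<n. T\<^sub>m * (n - 1 - m)!)\<close>; this is \<open>strong_positions_distribution\<close>.

  Finally let \<open>P\<^sub>n\<close> be the distribution over \<open>n\<close> letters of a statistic of the part
  after the minimum. If the first letter is the minimum, that part is all the rest;
  otherwise the first letter can be deleted. Hence \<open>P\<^sub>n\<^sub>+\<^sub>1 = n * P\<^sub>n + T\<^sub>n\<close>, whose
  solution is the asserted sum; this is \<open>sum_suffix_after_min\<close>.

  Words are lists over arbitrary finite sets of letters, so that deleting a letter or cutting a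
  word needs no standardisation: the distributions depend only on the number of letters.
\<close>

unbundle fps_syntax

section \<open>Strong points\<close>

definition strong_positions :: "'a::linorder list \<Rightarrow> nat set" where
  "strong_positions xs =
     {i. i < length xs \<and> (\<forall>j<i. xs ! j < xs ! i) \<and> (\<forall>j. i < j \<and> j < length xs \<longrightarrow> xs ! i < xs ! j)}"

lemma finite_strong_positions [simp]: "finite (strong_positions xs)"
  by (rule finite_subset[of _ "{..<length xs}"]) (auto simp: strong_positions_def)

lemma length_strong_position:
  assumes "\<forall>y\<in>set ys. y < x" "\<forall>z\<in>set zs. x < z"
  shows "length ys \<in> strong_positions (ys @ x # zs)"
  using assms by (auto simp: strong_positions_def nth_append nth_Cons')

lemma strong_positions_before:
  assumes "\<forall>y\<in>set ys. y < x" "\<forall>z\<in>set zs. x < z"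
  shows "{j \<in> strong_positions (ys @ x # zs). j < length ys} = strong_positions ys"
proof (intro set_eqI iffI)
  fix j assume "j \<in> {j \<in> strong_positions (ys @ x # zs). j < length ys}"
  then have s: "j \<in> strong_positions (ys @ x # zs)" and j: "j < length ys" by auto
  have "ys ! j < ys ! k" if "j < k" "k < length ys" for k
  proof -
    have "(ys @ x # zs) ! j < (ys @ x # zs) ! k"
      using s that by (simp add: strong_positions_def)
    then show ?thesis using that j by (simp add: nth_append)
  qed
  moreover have "ys ! k < ys ! j" if "k < j" for k
  proof -
    have "(ys @ x # zs) ! k < (ys @ x # zs) ! j"
      using s that by (simp add: strong_positions_def)
    then show ?thesis using that j by (simp add: nth_append)
  qed
  ultimately show "j \<in> strong_positions ys" using j by (simp add: strong_positions_def)
next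
  fix j assume s: "j \<in> strong_positions ys"
  then have j: "j < length ys" by (simp add: strong_positions_def)
  then have "ys ! j < x" using assms(1) by simp
  then have "ys ! j < (ys @ x # zs) ! k" if "j < k" "k < length (ys @ x # zs)" for k
    using s assms(2) that
    by (cases "k < length ys"; cases "k = length ys")
      (auto simp: strong_positions_def nth_append nth_Cons' intro: less_trans)
  then show "j \<in> {j \<in> strong_positions (ys @ x # zs). j < length ys}"
    using j s by (auto simp: strong_positions_def nth_append)
qed

text \<open>
  The ranks of the elements of a finite chain run once through \<open>0, 1, 2, \<dots>\<close>. This turns the
  marking weights into a geometric sum, and the sum over a marked letter into a sum over the
  length of the part before it.
\<close>

lemma sum_over_ranks:
  fixes S :: "'a::linorder set" and f :: "nat \<Rightarrow> 'b::comm_monoid_add"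
  assumes "finite S"
  shows "(\<Sum>x\<in>S. f (card {y \<in> S. y < x})) = (\<Sum>i<card S. f i)"
  using assms
proof (induction rule: finite_linorder_max_induct)
  case (insert b A)
  have "b \<notin> A" using insert.hyps by auto
  have "{y \<in> insert b A. y < b} = A" using insert.hyps by auto
  moreover have "{y \<in> insert b A. y < x} = {y \<in> A. y < x}" if "x \<in> A" for x
    using insert.hyps that by auto
  ultimately show ?case
    using \<open>b \<notin> A\<close> insert by (simp add: add.commute)
qed simp

text \<open>
  A geometric sum over the ranks of the strong points. Marking a strong point and counting only those
  before it is what makes the part after the mark free.\<close>

lemma sum_marked_strong_positions:
  fixes q :: "'b::comm_ring_1"
  shows "q ^ card (strong_positions xs)
     + (1 - q) * (\<Sum>i\<in>strong_positions xs. q ^ card {j \<in> strong_positions xs. j < i}) = 1"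
  by (subst sum_over_ranks) (simp_all flip: one_diff_power_eq)

text \<open>
  The letters before a strong point \<open>x\<close> are exactly those below \<open>x\<close>, those after it exactly those
  above, and conversely any two arrangements of these letters can be put around \<open>x\<close>.
\<close>

lemma bij_betw_split_at_strong_position:
  fixes V :: "'a::linorder set"
  shows "bij_betw (\<lambda>(x, ys, zs). (ys @ x # zs, length ys))
     (SIGMA x:V. permutations_of_set {y \<in> V. y < x} \<times> permutations_of_set {y \<in> V. x < y})
     (SIGMA xs:permutations_of_set V. strong_positions xs)"
proof (rule bij_betw_byWitness[where f' = "\<lambda>(xs, i). (xs ! i, take i xs, drop (Suc i) xs)"], goal_cases)
  case 2
  have "take i xs @ xs ! i # drop (Suc i) xs = xs" "length (take i xs) = i"
    if "i \<in> strong_positions xs" for xs :: "'a list" and i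
    using id_take_nth_drop[of i xs] that by (auto simp: strong_positions_def)
  then show ?case
    by (simp only: split_beta fst_conv snd_conv split_paired_Ball_Sigma prod.inject) blast
next
  case 3
  show ?case
  proof clarify
    fix x ys zs
    assume "x \<in> V" "ys \<in> permutations_of_set {y \<in> V. y < x}" "zs \<in> permutations_of_set {y \<in> V. x < y}"
    then have d: "distinct ys" "distinct zs" and set: "set ys = {y \<in> V. y < x}" "set zs = {y \<in> V. x < y}"
      by (simp_all add: permutations_of_set_def)
    have lt: "\<forall>y\<in>set ys. y < x" "\<forall>z\<in>set zs. x < z"
      unfolding set by simp_all
    have "set (ys @ x # zs) = V"
      using \<open>x \<in> V\<close> by (force simp: set)
    moreover have "distinct (ys @ x # zs)"
      using d lt by (auto dest: less_asym)
    ultimately show "ys @ x # zs \<in> permutations_of_set V \<and> length ys \<in> strong_positions (ys @ x # zs)"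
      using length_strong_position[OF lt] by (simp add: permutations_of_set_def)
  qed
next
  case 4
  show ?case
  proof clarify
    fix xs i
    assume xs: "xs \<in> permutations_of_set V" and s: "i \<in> strong_positions xs"
    then have i: "i < length xs" by (simp add: strong_positions_def)
    have V: "V = set xs" and d: "distinct xs" using xs by (auto simp: permutations_of_set_def)
    have split: "xs = take i xs @ xs ! i # drop (Suc i) xs" by (rule id_take_nth_drop[OF i])
    have lo: "y < xs ! i" if "y \<in> set (take i xs)" for y
      using that s by (auto simp: in_set_conv_nth strong_positions_def)
    have hi: "xs ! i < y" if "y \<in> set (drop (Suc i) xs)" for y
      using that s by (auto simp: in_set_conv_nth strong_positions_def)
    have "V = set (take i xs @ xs ! i # drop (Suc i) xs)" using V split by metis
    then have V': "V = set (take i xs) \<union> {xs ! i} \<union> set (drop (Suc i) xs)" by auto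
    have "{y \<in> V. y < xs ! i} = set (take i xs)" "{y \<in> V. xs ! i < y} = set (drop (Suc i) xs)"
      unfolding V' using lo hi by (auto dest: less_asym)
    then show "xs ! i \<in> V \<and> (take i xs, drop (Suc i) xs) \<in>
        permutations_of_set {y \<in> V. y < xs ! i} \<times> permutations_of_set {y \<in> V. xs ! i < y}"
      using d i V by (auto simp: permutations_of_set_def)
  qed
qed auto

lemma sum_marked_strong_positions_permutations:
  fixes V :: "'a::linorder set" and q :: "'b::{comm_ring_1, semiring_char_0}"
  assumes "finite V"
  shows "(\<Sum>xs\<in>permutations_of_set V. \<Sum>i\<in>strong_positions xs.
            q ^ card {j \<in> strong_positions xs. j < i})
       = (\<Sum>x\<in>V. (\<Sum>ys\<in>permutations_of_set {y \<in> V. y < x}. q ^ card (strong_positions ys))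
            * fact (card {y \<in> V. x < y}))"
proof -
  let ?L = "\<lambda>x. permutations_of_set {y \<in> V. y < x}" and ?H = "\<lambda>x. permutations_of_set {y \<in> V. x < y}"
  have before: "{j \<in> strong_positions (ys @ x # zs). j < length ys} = strong_positions ys"
    if "ys \<in> ?L x" "zs \<in> ?H x" for x ys zs
  proof -
    have "set ys = {y \<in> V. y < x}" "set zs = {y \<in> V. x < y}"
      using that by (simp_all add: permutations_of_set_def)
    then show ?thesis by (intro strong_positions_before) simp_all
  qed
  have "(\<Sum>xs\<in>permutations_of_set V. \<Sum>i\<in>strong_positions xs. q ^ card {j \<in> strong_positions xs. j < i})
      = (\<Sum>(xs, i)\<in>(SIGMA xs:permutations_of_set V. strong_positions xs).
            q ^ card {j \<in> strong_positions xs. j < i})"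
    by (rule sum.Sigma) auto
  also have "\<dots> = (\<Sum>(x, ys, zs)\<in>(SIGMA x:V. ?L x \<times> ?H x). q ^ card (strong_positions ys))"
    by (rule sum.reindex_bij_betw[OF bij_betw_split_at_strong_position, symmetric, THEN trans],
        rule sum.cong[OF refl], clarify, simp only: prod.case before)
  also have "\<dots> = (\<Sum>x\<in>V. \<Sum>(ys, zs)\<in>?L x \<times> ?H x. q ^ card (strong_positions ys))"
    by (rule sum.Sigma[symmetric]) (use assms in auto)
  also have "\<dots> = (\<Sum>x\<in>V. (\<Sum>ys\<in>?L x. q ^ card (strong_positions ys)) * fact (card {y \<in> V. x < y}))"
    using assms by (simp add: sum.cartesian_product[symmetric] sum_distrib_left mult.commute)
  finally show ?thesis .
qed

text \<open>
  The coefficient of \<open>t\<^sup>n\<close> in \<open>T + t (1 - q) T F = F\<close>. It determines all \<open>T_poly n\<close>, so any family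
  that satisfies it is \<open>T_poly\<close>.
\<close>

lemma T_poly_recurrence:
  "T_poly n + (1 - fps_X) * (\<Sum>m<n. T_poly m * fact (n - Suc m)) = fact n"
proof -
  define T where "T = perm_gf / (1 + var_t * (1 - var_q) * perm_gf)"
  have T: "T $ m = T_poly m" for m by (simp add: T_poly_def T_def)
  have "perm_gf = T * (1 + var_t * (1 - var_q) * perm_gf)"
    using T_poly_quotient by (simp add: T_def)
  also have "\<dots> = T + var_t * (fps_const (1 - fps_X) * (T * perm_gf))"
    by (simp add: algebra_simps flip: fps_const_sub)
  finally have "perm_gf $ n = T $ n + (var_t * (fps_const (1 - fps_X) * (T * perm_gf))) $ n"
    by (metis fps_add_nth)
  moreover have "(T * perm_gf) $ k = (\<Sum>m\<le>k. T_poly m * fact (k - m))" for k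
    by (simp add: fps_mult_nth T perm_gf_def atLeast0AtMost)
  ultimately show ?thesis
    by (cases n) (simp_all add: T perm_gf_def lessThan_Suc_atMost fps_X_mult_nth del: fact_Suc)
qed

text \<open>
  The strong point distribution satisfies the recurrence of \<open>T_poly\<close>: the words with and
  without a mark have total weight \<open>1\<close> per word, and splitting the marked ones at the mark
  leads back to fewer letters.
\<close>

lemma strong_positions_distribution:
  fixes V :: "'a::linorder set"
  assumes "finite V"
  shows "(\<Sum>xs\<in>permutations_of_set V. fps_X ^ card (strong_positions xs)) = T_poly (card V)"
  using assms
proof (induction "card V" arbitrary: V rule: less_induct)
  case less
  let ?T = "\<lambda>V :: 'a set. \<Sum>xs\<in>permutations_of_set V. (fps_X :: rat fps) ^ card (strong_positions xs)"
  have eq: "?T {y \<in> V. y < x} * fact (card {y \<in> V. x < y}) =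
      T_poly (card {y \<in> V. y < x}) * fact (card V - Suc (card {y \<in> V. y < x}))" if "x \<in> V" for x
  proof -
    have V: "V = insert x ({y \<in> V. y < x} \<union> {y \<in> V. x < y})" using that by auto
    have "card V = Suc (card ({y \<in> V. y < x} \<union> {y \<in> V. x < y}))"
      by (subst V, subst card_insert_disjoint) (use less.prems in auto)
    also have "card ({y \<in> V. y < x} \<union> {y \<in> V. x < y}) = card {y \<in> V. y < x} + card {y \<in> V. x < y}"
      by (rule card_Un_disjoint) (use less.prems in auto)
    finally have card: "card V = Suc (card {y \<in> V. y < x} + card {y \<in> V. x < y})" .
    then have "?T {y \<in> V. y < x} = T_poly (card {y \<in> V. y < x})"
      using less by simp
    then show ?thesis using card by simp
  qed
  have "(\<Sum>xs\<in>permutations_of_set V. fps_X ^ card (strong_positions xs)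
     + (1 - fps_X) * (\<Sum>i\<in>strong_positions xs. fps_X ^ card {j \<in> strong_positions xs. j < i}))
     = (fact (card V) :: rat fps)"
    unfolding sum_marked_strong_positions using less.prems by simp
  then have "?T V + (1 - fps_X) * (\<Sum>x\<in>V. ?T {y \<in> V. y < x} * fact (card {y \<in> V. x < y}))
     = fact (card V)"
    by (simp only: sum.distrib sum_distrib_left[symmetric]
        sum_marked_strong_positions_permutations[OF less.prems])
  also have "(\<Sum>x\<in>V. ?T {y \<in> V. y < x} * fact (card {y \<in> V. x < y}))
     = (\<Sum>x\<in>V. T_poly (card {y \<in> V. y < x}) * fact (card V - Suc (card {y \<in> V. y < x})))"
    by (rule sum.cong[OF refl eq])
  also have "\<dots> = (\<Sum>m<card V. T_poly m * fact (card V - Suc m))"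
    by (rule sum_over_ranks[OF less.prems])
  finally show ?case
    using T_poly_recurrence[of "card V"] by (metis add_right_imp_eq)
qed

section \<open>The part of a permutation after its minimum\<close>

fun suffix_after_min :: "'a::linorder list \<Rightarrow> 'a list" where
  "suffix_after_min [] = []"
| "suffix_after_min (x # xs) = (if \<forall>y\<in>set xs. x < y then xs else suffix_after_min xs)"

lemma suffix_after_min_append:
  assumes "\<forall>y\<in>set ys \<union> set zs. x < y"
  shows "suffix_after_min (ys @ x # zs) = zs"
  using assms by (induction ys) (auto dest: less_asym)

lemma sum_permutations_of_set_Cons:
  fixes f :: "'a list \<Rightarrow> 'b::comm_monoid_add"
  assumes "finite V" "V \<noteq> {}"
  shows "(\<Sum>xs\<in>permutations_of_set V. f xs) =
    (\<Sum>x\<in>V. \<Sum>ys\<in>permutations_of_set (V - {x}). f (x # ys))"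
proof -
  have "(\<Sum>xs\<in>permutations_of_set V. f xs) =
      (\<Sum>x\<in>V. \<Sum>xs\<in>(#) x ` permutations_of_set (V - {x}). f xs)"
    unfolding permutations_of_set_nonempty[OF assms(2)]
    by (rule sum.UNION_disjoint) (use assms in auto)
  also have "\<dots> = (\<Sum>x\<in>V. \<Sum>ys\<in>permutations_of_set (V - {x}). f (x # ys))"
    by (simp add: sum.reindex)
  finally show ?thesis .
qed

text \<open>
  Induction over the number of letters, deleting the first one. The new summand \<open>c (Suc n)\<close>
  comes from the words that start with their minimum; each of the other \<open>Suc n\<close> first letters
  reproduces the sum for one letter less, which raises every \<open>fact n / fact m\<close> to
  \<open>fact (Suc n) / fact m\<close>.
\<close>

lemma sum_suffix_after_min:
  fixes V :: "'a::linorder set" and f :: "'a list \<Rightarrow> rat fps"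
  assumes "finite V"
    and f: "\<And>W. finite W \<Longrightarrow> (\<Sum>xs\<in>permutations_of_set W. f xs) = c (card W)"
    and "card V = Suc n"
  shows "(\<Sum>xs\<in>permutations_of_set V. f (suffix_after_min xs)) =
    (\<Sum>m\<le>n. fps_const (fact n / fact m) * c m)"
  using assms(1,3)
proof (induction n arbitrary: V)
  case 0
  then obtain x where "V = {x}" by (auto simp: card_1_singleton_iff)
  then show ?case using f[of "{}"] by simp
next
  case (Suc n)
  have ne: "V \<noteq> {}" using Suc.prems by auto
  have min: "(\<Sum>ys\<in>permutations_of_set (V - {Min V}). f (suffix_after_min (Min V # ys))) = c (Suc n)"
  proof -
    have "\<forall>y\<in>set ys. Min V < y" if "ys \<in> permutations_of_set (V - {Min V})" for ys
      using that Suc.prems by (auto simp: permutations_of_set_def less_le)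
    then show ?thesis
      using f[of "V - {Min V}"] Suc.prems ne by simp
  qed
  have other: "(\<Sum>ys\<in>permutations_of_set (V - {x}). f (suffix_after_min (x # ys)))
      = (\<Sum>m\<le>n. fps_const (fact n / fact m) * c m)" if "x \<in> V - {Min V}" for x
  proof -
    have "\<not> (\<forall>y\<in>set ys. x < y)" if "ys \<in> permutations_of_set (V - {x})" for ys
    proof -
      have "Min V \<in> set ys" "Min V \<le> x"
        using that \<open>x \<in> V - {Min V}\<close> Suc.prems ne by (auto simp: permutations_of_set_def)
      then show ?thesis by (auto simp: not_less)
    qed
    then have "(\<Sum>ys\<in>permutations_of_set (V - {x}). f (suffix_after_min (x # ys)))
       = (\<Sum>ys\<in>permutations_of_set (V - {x}). f (suffix_after_min ys))"
      by (intro sum.cong) auto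
    then show ?thesis using Suc.IH[of "V - {x}"] Suc.prems that by simp
  qed
  have "(\<Sum>xs\<in>permutations_of_set V. f (suffix_after_min xs)) =
     c (Suc n) + (\<Sum>x\<in>V - {Min V}. \<Sum>m\<le>n. fps_const (fact n / fact m) * c m)"
    unfolding sum_permutations_of_set_Cons[OF Suc.prems(1) ne]
      sum.remove[OF Suc.prems(1) Min_in[OF Suc.prems(1) ne]] min
    by (simp only: other cong: sum.cong)
  also have "\<dots> = c (Suc n) + of_nat (Suc n) * (\<Sum>m\<le>n. fps_const (fact n / fact m) * c m)"
    using Suc.prems ne by simp
  also have "of_nat (Suc n) * (\<Sum>m\<le>n. fps_const (fact n / fact m) * c m)
     = (\<Sum>m\<le>n. fps_const (fact (Suc n) / fact m) * c m)"
    unfolding sum_distrib_left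
    by (rule sum.cong) (simp_all add: fps_of_nat[symmetric] mult.assoc[symmetric] del: of_nat_Suc)
  finally show ?case by simp
qed

lemma sum_permutations_of_set_rev:
  "(\<Sum>xs\<in>permutations_of_set V. f (rev xs)) = (\<Sum>xs\<in>permutations_of_set V. f xs)"
  by (rule sum.reindex_bij_betw) (simp add: bij_betw_def)

section \<open>Counting occurrences\<close>

lemma bij_betw_one_line_notation:
  "bij_betw (\<lambda>\<sigma>. map \<sigma> [1..<Suc n]) {\<sigma>. \<sigma> permutes {1..n}} (permutations_of_set {1..n})"
proof -
  let ?w = "\<lambda>\<sigma> :: nat \<Rightarrow> nat. map \<sigma> [1..<Suc n]"
  have inj: "inj_on ?w {\<sigma>. \<sigma> permutes {1..n}}"
  proof (rule inj_onI, rule ext)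
    fix \<sigma> \<tau> :: "nat \<Rightarrow> nat" and i
    assume "\<sigma> \<in> {\<sigma>. \<sigma> permutes {1..n}}" "\<tau> \<in> {\<sigma>. \<sigma> permutes {1..n}}" "?w \<sigma> = ?w \<tau>"
    then have "\<sigma> permutes {1..n}" "\<tau> permutes {1..n}" "\<forall>i\<in>{1..<Suc n}. \<sigma> i = \<tau> i"
      by (simp_all only: mem_Collect_eq map_eq_conv set_upt)
    then show "\<sigma> i = \<tau> i"
      by (cases "i \<in> {1..n}") (auto simp: permutes_not_in)
  qed
  have sub: "?w ` {\<sigma>. \<sigma> permutes {1..n}} \<subseteq> permutations_of_set {1..n}"
  proof clarify
    fix \<sigma> assume s: "\<sigma> permutes {1..n}"
    have "{1..<Suc n} = {1..n}" by auto
    then show "?w \<sigma> \<in> permutations_of_set {1..n}"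
      using permutes_image[OF s] permutes_inj_on[OF s]
      by (intro permutations_of_setI) (simp_all only: set_map set_upt distinct_map distinct_upt simp_thms)
  qed
  have "card (?w ` {\<sigma>. \<sigma> permutes {1..n}}) = card (permutations_of_set {1..n})"
    using card_permutations[of "{1..n}" n] by (simp only: card_image[OF inj]) simp
  then have "?w ` {\<sigma>. \<sigma> permutes {1..n}} = permutations_of_set {1..n}"
    by (intro card_subset_eq sub) simp_all
  with inj show ?thesis by (simp only: bij_betw_def simp_thms)
qed

lemma mesh12_gf_nth:
  "fps_nth (mesh12_gf R) n =
     (\<Sum>\<sigma> | \<sigma> permutes {1..n}. fps_X ^ card (mesh12_occurrences R n \<sigma>))"
proof (rule fps_ext)
  fix k
  have fin: "finite {\<sigma>. \<sigma> permutes {1..n}}" by (rule finite_permutations) simp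
  have "(\<Sum>\<sigma> | \<sigma> permutes {1..n}. fps_X ^ card (mesh12_occurrences R n \<sigma>)) $ k =
      (\<Sum>\<sigma> | \<sigma> permutes {1..n}. if card (mesh12_occurrences R n \<sigma>) = k then 1 else 0 :: rat)"
    by (auto simp: fps_sum_nth intro!: sum.cong)
  also have "\<dots> = of_nat (mesh12_count R n k)"
    using fin by (simp add: mesh12_count_def sum.If_cases Int_def)
  finally show "fps_nth (mesh12_gf R) n $ k = 
     (\<Sum>\<sigma> | \<sigma> permutes {1..n}. fps_X ^ card (mesh12_occurrences R n \<sigma>)) $ k"
    by (simp add: mesh12_gf_def)
qed


lemma suffix_after_min_one_line_notation:
  assumes \<sigma>: "\<sigma> permutes {1..n}" and p: "p \<in> {1..n}" "\<sigma> p = 1"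
  shows "suffix_after_min (map \<sigma> [1..<Suc n]) = map \<sigma> [Suc p..<Suc n]"
proof -
  have split: "[1..<Suc n] = [1..<p] @ p # [Suc p..<Suc n]"
    using p upt_add_eq_append[of 1 p "Suc n - p"] upt_conv_Cons[of p "Suc n"] by simp
  have less: "\<sigma> p < \<sigma> l" if "l \<in> {1..<p} \<union> {Suc p..<Suc n}" for l
  proof -
    have "l \<in> {1..n}" "l \<noteq> p" using that p by auto
    then have "\<sigma> l \<in> {1..n}" "\<sigma> l \<noteq> \<sigma> p"
      using permutes_in_image[OF \<sigma>, of l] inj_eq[OF permutes_inj[OF \<sigma>]] by auto
    then show ?thesis using p by auto
  qed
  have "\<forall>y\<in>set (map \<sigma> [1..<p]) \<union> set (map \<sigma> [Suc p..<Suc n]). \<sigma> p < y"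
    using less by (auto simp del: upt_Suc)
  from suffix_after_min_append[OF this] show ?thesis
    by (simp only: split map_append list.map)
qed

text \<open>
  List positions are counted from \<open>0\<close>, positions of a permutation from \<open>1\<close>; the next two
  lemmas move the strong points of a segment of a permutation, and of its reversal, to the
  positions of the permutation.
\<close>

lemma card_strong_positions_map_upt:
  fixes f :: "nat \<Rightarrow> 'a::linorder"
  shows "card (strong_positions (map f [a..<c])) =
    card {b \<in> {a..<c}. (\<forall>l\<in>{a..<b}. f l < f b) \<and> (\<forall>l\<in>{b<..<c}. f b < f l)}"
proof (rule bij_betw_same_card, rule bij_betw_byWitness[where f = "\<lambda>i. a + i" and f' = "\<lambda>b. b - a"], goal_cases)
  case 3
  show ?case
  proof clarsimp
    fix i assume "i \<in> strong_positions (map f [a..<c])"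
    then have i: "i < c - a" "\<And>j. j < i \<Longrightarrow> f (a + j) < f (a + i)"
      "\<And>j. i < j \<Longrightarrow> j < c - a \<Longrightarrow> f (a + i) < f (a + j)"
      by (auto simp: strong_positions_def)
    have "f l < f (a + i)" if "a \<le> l" "l < a + i" for l
      using i(2)[of "l - a"] that by auto
    moreover have "f (a + i) < f l" if "a + i < l" "l < c" for l
      using i(3)[of "l - a"] that by auto
    ultimately show "a + i < c \<and> (\<forall>l\<in>{a..<a + i}. f l < f (a + i)) \<and> (\<forall>l\<in>{a + i<..<c}. f (a + i) < f l)"
      using i(1) by auto
  qed
next
  case 4
  show ?case
  proof clarsimp
    fix b
    assume b: "a \<le> b" "b < c" "\<forall>l\<in>{a..<b}. f l < f b" "\<forall>l\<in>{b<..<c}. f b < f l"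
    have "f (a + j) < f b" if "j < b - a" for j using b(3) that by auto
    moreover have "f b < f (a + j)" if "b - a < j" "j < c - a" for j
    proof -
      have "b < a + j" "a + j < c" using that b(1) by linarith+
      then show ?thesis using b(4) by auto
    qed
    ultimately show "b - a \<in> strong_positions (map f [a..<c])"
      using b(1,2) by (auto simp: strong_positions_def)
  qed
qed (auto simp: strong_positions_def)

lemma card_strong_positions_rev_map_upt:
  fixes f :: "nat \<Rightarrow> 'a::linorder"
  shows "card (strong_positions (rev (map f [a..<c]))) =
    card {b \<in> {a..<c}. (\<forall>l\<in>{a..<b}. f b < f l) \<and> (\<forall>l\<in>{b<..<c}. f l < f b)}"
proof (rule bij_betw_same_card,
    rule bij_betw_byWitness[where f = "\<lambda>i. c - Suc i" and f' = "\<lambda>b. c - Suc b"], goal_cases)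
  case 3
  show ?case
  proof clarsimp
    fix i assume "i \<in> strong_positions (rev (map f [a..<c]))"
    then have i: "i < c - a" "\<And>j. j < i \<Longrightarrow> f (c - Suc j) < f (c - Suc i)"
      "\<And>j. i < j \<Longrightarrow> j < c - a \<Longrightarrow> f (c - Suc i) < f (c - Suc j)"
      by (auto simp: strong_positions_def rev_nth)
    have "f l < f (c - Suc i)" if "c - Suc i < l" "l < c" for l
      using i(1) i(2)[of "c - Suc l"] that by auto
    moreover have "f (c - Suc i) < f l" if "a \<le> l" "l < c - Suc i" for l
      using i(3)[of "c - Suc l"] that by auto
    ultimately show "a \<le> c - Suc i \<and> c - Suc i < c \<and>
        (\<forall>l\<in>{a..<c - Suc i}. f (c - Suc i) < f l) \<and> (\<forall>l\<in>{c - Suc i<..<c}. f l < f (c - Suc i))"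
      using i(1) by auto
  qed
next
  case 4
  show ?case
  proof clarsimp
    fix b
    assume b: "a \<le> b" "b < c" "\<forall>l\<in>{a..<b}. f b < f l" "\<forall>l\<in>{b<..<c}. f l < f b"
    have "f (c - Suc j) < f b" if "j < c - Suc b" for j using b(4) that by auto
    moreover have "f b < f (c - Suc j)" if "c - Suc b < j" "j < c - a" for j
    proof -
      have "a \<le> c - Suc j" "c - Suc j < b" using that b(2) by linarith+
      then show ?thesis using b(3) by auto
    qed
    ultimately show "c - Suc b \<in> strong_positions (rev (map f [a..<c]))"
      using b(1,2) by (auto simp: strong_positions_def rev_nth)
  qed
qed (auto simp: strong_positions_def)

text \<open>
  Were the first entry not the value \<open>1\<close>, then that value would lie in one of the three
  columns, below the first entry, hence in a shaded cell.
\<close>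

lemma mesh12_occurrence_bottom_row:
  assumes \<sigma>: "\<sigma> permutes {1..n}" and p: "p \<in> {1..n}" "\<sigma> p = 1"
    and R: "(0,0) \<in> R" "(1,0) \<in> R" "(2,0) \<in> R" and occ: "mesh12_occurrence R n \<sigma> i1 i2"
  shows "i1 = p"
proof (rule ccontr)
  assume "i1 \<noteq> p"
  have i: "1 \<le> i1" "i1 < i2" "i2 \<le> n" "\<sigma> i1 < \<sigma> i2"
    using occ by (auto simp: mesh12_occurrence_def)
  have "\<sigma> i1 \<in> {1..n}" using permutes_in_image[OF \<sigma>, of i1] i by auto
  moreover have "\<sigma> i1 \<noteq> 1" using \<open>i1 \<noteq> p\<close> p inj_eq[OF permutes_inj[OF \<sigma>], of i1 p] by auto
  ultimately have "\<sigma> p < \<sigma> i1" using p by auto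
  have "p \<noteq> i2" using \<open>\<sigma> p < \<sigma> i1\<close> i by auto
  have no: "\<not> ([0, i1, i2, n + 1] ! x < p \<and> p < [0, i1, i2, n + 1] ! (x + 1)
      \<and> [0, \<sigma> i1, \<sigma> i2, n + 1] ! y < \<sigma> p \<and> \<sigma> p < [0, \<sigma> i1, \<sigma> i2, n + 1] ! (y + 1))"
    if "(x, y) \<in> R" for x y
    using occ that unfolding mesh12_occurrence_def Let_def by blast
  consider "p < i1" | "i1 < p" "p < i2" | "i2 < p" using \<open>i1 \<noteq> p\<close> \<open>p \<noteq> i2\<close> by linarith
  then show False
    using no[OF R(1)] no[OF R(2)] no[OF R(3)] p \<open>\<sigma> p < \<sigma> i1\<close>
    by cases (auto simp: numeral_2_eq_2)
qed

text \<open>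
  With \<open>1\<close> as the first entry, at position \<open>p\<close>, nothing lies below it, and the positions
  before \<open>p\<close> are in no further shaded cell. So the remaining two cells only constrain the
  word after \<open>p\<close>. A strong point of the reversed word has larger entries before it and smaller
  ones after it, which is what the cells \<open>(1,1)\<close> and \<open>(2,2)\<close> ask for.
\<close>

lemma card_mesh12_occurrences_bottom_row:
  assumes \<sigma>: "\<sigma> permutes {1..n}" and n: "n \<ge> 1"
  shows "card (mesh12_occurrences {(1,2),(2,1),(0,0),(1,0),(2,0)} n \<sigma>) =
      card (strong_positions (suffix_after_min (map \<sigma> [1..<Suc n])))" (is ?thesis1)
    and "card (mesh12_occurrences {(2,2),(1,1),(0,0),(1,0),(2,0)} n \<sigma>) =
      card (strong_positions (rev (suffix_after_min (map \<sigma> [1..<Suc n]))))" (is ?thesis2)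
proof -
  define p where "p = inv \<sigma> 1"
  have p: "p \<in> {1..n}" "\<sigma> p = 1"
    using permutes_in_image[OF permutes_inv[OF \<sigma>], of 1] permutes_inverses(1)[OF \<sigma>] n
    by (auto simp: p_def)
  have range: "\<sigma> l \<in> {1..n}" if "l \<in> {1..n}" for l
    using permutes_in_image[OF \<sigma>] that by blast
  have inj: "\<sigma> l = \<sigma> m \<longleftrightarrow> l = m" for l m
    by (rule inj_eq[OF permutes_inj[OF \<sigma>]])
  have one: "1 < \<sigma> l" if "p < l" "l \<le> n" for l
    using range[of l] inj[of l p] that p by fastforce
  let ?S = "{b \<in> {Suc p..<Suc n}. (\<forall>l\<in>{Suc p..<b}. \<sigma> l < \<sigma> b) \<and> (\<forall>l\<in>{b<..<Suc n}. \<sigma> b < \<sigma> l)}"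
  let ?D = "{b \<in> {Suc p..<Suc n}. (\<forall>l\<in>{Suc p..<b}. \<sigma> b < \<sigma> l) \<and> (\<forall>l\<in>{b<..<Suc n}. \<sigma> l < \<sigma> b)}"
  have S: "mesh12_occurrence {(1,2),(2,1),(0,0),(1,0),(2,0)} n \<sigma> p b \<longleftrightarrow> b \<in> ?S" for b
  proof -
    have "mesh12_occurrence {(1,2),(2,1),(0,0),(1,0),(2,0)} n \<sigma> p b \<longleftrightarrow> p < b \<and> b \<le> n \<and> \<sigma> p < \<sigma> b
      \<and> (\<forall>l. \<not> (p < l \<and> l < b \<and> \<sigma> b < \<sigma> l \<and> \<sigma> l < n + 1))
      \<and> (\<forall>l. \<not> (b < l \<and> l < n + 1 \<and> \<sigma> p < \<sigma> l \<and> \<sigma> l < \<sigma> b))"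
      using p by (auto simp: mesh12_occurrence_def numeral_2_eq_2)
    also have "\<dots> \<longleftrightarrow> p < b \<and> b \<le> n \<and> (\<forall>l. p < l \<and> l < b \<longrightarrow> \<sigma> l < \<sigma> b) \<and> (\<forall>l. b < l \<and> l \<le> n \<longrightarrow> \<sigma> b < \<sigma> l)"
    proof (cases "p < b \<and> b \<le> n")
      case True
      have "\<sigma> l \<noteq> \<sigma> b" if "l \<noteq> b" for l using inj that by simp
      moreover have "\<sigma> l < n + 1" if "p < l" "l \<le> n" for l using range[of l] that by auto
      ultimately show ?thesis
        using True one p(2) unfolding less_Suc_eq_le[symmetric] Suc_eq_plus1
        by (smt (verit) less_trans linorder_neqE_nat less_asym)
    qed blast
    also have "\<dots> \<longleftrightarrow> b \<in> ?S" by auto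
    finally show ?thesis .
  qed
  have D: "mesh12_occurrence {(2,2),(1,1),(0,0),(1,0),(2,0)} n \<sigma> p b \<longleftrightarrow> b \<in> ?D" for b
  proof -
    have "mesh12_occurrence {(2,2),(1,1),(0,0),(1,0),(2,0)} n \<sigma> p b \<longleftrightarrow> p < b \<and> b \<le> n \<and> \<sigma> p < \<sigma> b
      \<and> (\<forall>l. \<not> (p < l \<and> l < b \<and> \<sigma> p < \<sigma> l \<and> \<sigma> l < \<sigma> b))
      \<and> (\<forall>l. \<not> (b < l \<and> l < n + 1 \<and> \<sigma> b < \<sigma> l \<and> \<sigma> l < n + 1))"
      using p by (auto simp: mesh12_occurrence_def numeral_2_eq_2)
    also have "\<dots> \<longleftrightarrow> p < b \<and> b \<le> n \<and> (\<forall>l. p < l \<and> l < b \<longrightarrow> \<sigma> b < \<sigma> l) \<and> (\<forall>l. b < l \<and> l \<le> n \<longrightarrow> \<sigma> l < \<sigma> b)"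
    proof (cases "p < b \<and> b \<le> n")
      case True
      have "\<sigma> l \<noteq> \<sigma> b" if "l \<noteq> b" for l using inj that by simp
      moreover have "\<sigma> l < n + 1" if "p < l" "l \<le> n" for l using range[of l] that by auto
      ultimately show ?thesis
        using True one p(2) unfolding less_Suc_eq_le[symmetric] Suc_eq_plus1
        by (smt (verit) less_trans linorder_neqE_nat less_asym)
    qed blast
    also have "\<dots> \<longleftrightarrow> b \<in> ?D" by auto
    finally show ?thesis .
  qed
  have fibre: "card (mesh12_occurrences R n \<sigma>) = card {b. mesh12_occurrence R n \<sigma> p b}"
    if "(0,0) \<in> R" "(1,0) \<in> R" "(2,0) \<in> R" for R
  proof -
    have "mesh12_occurrences R n \<sigma> = Pair p ` {b. mesh12_occurrence R n \<sigma> p b}"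
    proof (intro equalityI subsetI)
      fix e assume "e \<in> mesh12_occurrences R n \<sigma>"
      then obtain i1 i2 where e: "e = (i1, i2)" and occ: "mesh12_occurrence R n \<sigma> i1 i2"
        by (auto simp: mesh12_occurrences_def)
      from mesh12_occurrence_bottom_row[OF \<sigma> p that occ] have "i1 = p" .
      then show "e \<in> Pair p ` {b. mesh12_occurrence R n \<sigma> p b}" using e occ by simp
    qed (auto simp: mesh12_occurrences_def)
    then show ?thesis by (simp add: card_image inj_on_def)
  qed
  show ?thesis1
    unfolding suffix_after_min_one_line_notation[OF \<sigma> p] card_strong_positions_map_upt
    by (subst fibre, simp_all only: insert_iff simp_thms, rule arg_cong[where f = card], rule set_eqI)
      (simp only: mem_Collect_eq S)
  show ?thesis2
    unfolding suffix_after_min_one_line_notation[OF \<sigma> p] card_strong_positions_rev_map_upt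
    by (subst fibre, simp_all only: insert_iff simp_thms, rule arg_cong[where f = card], rule set_eqI)
      (simp only: mem_Collect_eq D)
qed

lemma mesh12_gf_nth_bottom_row:
  assumes "R \<in> {{(1,2),(2,1),(0,0),(1,0),(2,0)}, {(2,2),(1,1),(0,0),(1,0),(2,0)}}"
  shows "fps_nth (mesh12_gf R) (Suc n) = (\<Sum>m\<le>n. fps_const (fact n / fact m) * T_poly m)"
proof -
  \<comment> \<open>Reversal permutes the words on a given set of letters, so the strong points of the
    reversed word have the same distribution and both shadings can be treated at once.\<close>
  define st :: "nat list \<Rightarrow> nat set" where
    "st = (if R = {(1,2),(2,1),(0,0),(1,0),(2,0)} then strong_positions else strong_positions \<circ> rev)"
  have st: "(\<Sum>xs\<in>permutations_of_set W. fps_X ^ card (st xs)) = T_poly (card W)" if "finite W" for W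
    using that by (simp add: st_def strong_positions_distribution
        sum_permutations_of_set_rev[of "\<lambda>xs. fps_X ^ card (strong_positions xs)"])
  have "fps_nth (mesh12_gf R) (Suc n) =
    (\<Sum>\<sigma> | \<sigma> permutes {1..Suc n}. fps_X ^ card (st (suffix_after_min (map \<sigma> [1..<Suc (Suc n)]))))"
    unfolding mesh12_gf_nth
  proof (rule sum.cong[OF refl])
    fix \<sigma> assume "\<sigma> \<in> {\<sigma>. \<sigma> permutes {1..Suc n}}"
    then have "\<sigma> permutes {1..Suc n}" "Suc n \<ge> 1" by auto
    note card_mesh12_occurrences_bottom_row[OF this]
    then show "fps_X ^ card (mesh12_occurrences R (Suc n) \<sigma>) =
        fps_X ^ card (st (suffix_after_min (map \<sigma> [1..<Suc (Suc n)])))"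
      using assms by (auto simp: st_def simp del: upt_Suc)
  qed
  also have "\<dots> = (\<Sum>xs\<in>permutations_of_set {1..Suc n}. fps_X ^ card (st (suffix_after_min xs)))"
    by (rule sum.reindex_bij_betw[OF bij_betw_one_line_notation])
  also have "\<dots> = (\<Sum>m\<le>n. fps_const (fact n / fact m) * T_poly m)"
    by (rule sum_suffix_after_min) (simp_all add: st)
  finally show ?thesis .
qed

section \<open>Symmetries\<close>

lemma mesh12_gf_eqI:
  assumes "\<And>n. bij_betw (\<Phi> n) {\<sigma>. \<sigma> permutes {1..n}} {\<sigma>. \<sigma> permutes {1..n}}"
    and "\<And>n \<sigma>. \<sigma> permutes {1..n} \<Longrightarrow>
      card (mesh12_occurrences R' n (\<Phi> n \<sigma>)) = card (mesh12_occurrences R n \<sigma>)"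
  shows "mesh12_gf R' = mesh12_gf R"
proof (rule fps_ext)
  fix n
  have "fps_nth (mesh12_gf R') n =
      (\<Sum>\<sigma> | \<sigma> permutes {1..n}. fps_X ^ card (mesh12_occurrences R' n (\<Phi> n \<sigma>)))"
    unfolding mesh12_gf_nth by (rule sum.reindex_bij_betw[OF assms(1), symmetric])
  also have "\<dots> = fps_nth (mesh12_gf R) n"
    unfolding mesh12_gf_nth by (rule sum.cong) (simp_all add: assms(2))
  finally show "fps_nth (mesh12_gf R') n = fps_nth (mesh12_gf R) n" .
qed

text \<open>
  The strips that cut the board into columns (with the two positions \<open>a\<close>, \<open>b\<close>) and into rows
  (with the two values) have the same form, so a symmetry needs to be understood for one
  family of strips only.
\<close>

definition in_strip :: "nat \<Rightarrow> nat \<Rightarrow> nat \<Rightarrow> nat \<Rightarrow> nat \<Rightarrow> bool" where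
  "in_strip n a b x l \<longleftrightarrow> [0, a, b, n + 1] ! x < l \<and> l < [0, a, b, n + 1] ! (x + 1)"

lemma mesh12_occurrence_iff:
  "mesh12_occurrence R n \<sigma> i1 i2 \<longleftrightarrow>
     1 \<le> i1 \<and> i1 < i2 \<and> i2 \<le> n \<and> \<sigma> i1 < \<sigma> i2 \<and>
     (\<forall>x y l. (x, y) \<in> R \<longrightarrow> in_strip n i1 i2 x l \<longrightarrow> \<not> in_strip n (\<sigma> i1) (\<sigma> i2) y (\<sigma> l))"
  unfolding mesh12_occurrence_def Let_def in_strip_def by blast

text \<open>
  Inversion reflects the diagram of a permutation in the main diagonal: columns become rows,
  and an increasing pair of points stays increasing.
\<close>

lemma mesh12_occurrence_inv:
  assumes \<sigma>: "\<sigma> permutes {1..n}" and occ: "mesh12_occurrence R n \<sigma> i1 i2"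
  shows "mesh12_occurrence (prod.swap ` R) n (inv \<sigma>) (\<sigma> i1) (\<sigma> i2)"
proof -
  have i: "1 \<le> i1" "i1 < i2" "i2 \<le> n" "\<sigma> i1 < \<sigma> i2"
    and no: "\<And>x y l. (x, y) \<in> R \<Longrightarrow> in_strip n i1 i2 x l \<Longrightarrow> \<not> in_strip n (\<sigma> i1) (\<sigma> i2) y (\<sigma> l)"
    using occ unfolding mesh12_occurrence_iff by blast+
  have "1 \<le> \<sigma> i1" "\<sigma> i2 \<le> n"
    using i permutes_in_image[OF \<sigma>, of i1] permutes_in_image[OF \<sigma>, of i2] by auto
  moreover have "\<not> in_strip n i1 i2 x (inv \<sigma> l)"
    if "(y, x) \<in> prod.swap ` R" "in_strip n (\<sigma> i1) (\<sigma> i2) y l" for x y l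
    using no[of x y "inv \<sigma> l"] that by (auto simp: permutes_inverses[OF \<sigma>])
  ultimately show ?thesis
    using i unfolding mesh12_occurrence_iff permutes_inverses(2)[OF \<sigma>] by blast
qed

lemma mesh12_gf_swap: "mesh12_gf (prod.swap ` R) = mesh12_gf R"
proof (rule mesh12_gf_eqI)
  show "bij_betw inv {\<sigma>. \<sigma> permutes {1..n}} {\<sigma>. \<sigma> permutes {1..n}}" for n :: nat
    by (rule bij_betw_byWitness[where f' = inv]) (auto simp: permutes_inv permutes_inv_inv)
next
  fix n and \<sigma> :: "nat \<Rightarrow> nat" assume \<sigma>: "\<sigma> permutes {1..n}"
  have "bij_betw (map_prod \<sigma> \<sigma>) (mesh12_occurrences R n \<sigma>) (mesh12_occurrences (prod.swap ` R) n (inv \<sigma>))"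
    using mesh12_occurrence_inv[OF \<sigma>, of R]
      mesh12_occurrence_inv[OF permutes_inv[OF \<sigma>], of "prod.swap ` R"]
    by (intro bij_betw_byWitness[where f' = "map_prod (inv \<sigma>) (inv \<sigma>)"])
      (auto simp: mesh12_occurrences_def permutes_inverses[OF \<sigma>] permutes_inv_inv[OF \<sigma>]
        image_image)
  then show "card (mesh12_occurrences (prod.swap ` R) n (inv \<sigma>)) = card (mesh12_occurrences R n \<sigma>)"
    by (rule bij_betw_same_card[symmetric])
qed

definition flip_in :: "nat \<Rightarrow> nat \<Rightarrow> nat" where
  "flip_in n l = (if l \<in> {1..n} then n + 1 - l else l)"

lemma flip_in_flip_in [simp]: "flip_in n (flip_in n l) = l"
  by (auto simp: flip_in_def)

lemma flip_in_permutes: "flip_in n permutes {1..n}"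
  by (rule bij_imp_permutes, rule bij_betw_byWitness[where f' = "flip_in n"])
    (auto simp: flip_in_def)

text \<open>
  The reverse-complement, which rotates the diagram of a permutation by a half turn. Outside
  \<open>{1..n}\<close> nothing is moved, so that the result permutes \<open>{1..n}\<close> again.
\<close>

definition rotate_perm :: "nat \<Rightarrow> (nat \<Rightarrow> nat) \<Rightarrow> nat \<Rightarrow> nat" where
  "rotate_perm n \<sigma> = flip_in n \<circ> \<sigma> \<circ> flip_in n"

lemma rotate_perm_rotate_perm [simp]: "rotate_perm n (rotate_perm n \<sigma>) = \<sigma>"
  by (simp add: rotate_perm_def fun_eq_iff)

lemma rotate_perm_permutes: "\<sigma> permutes {1..n} \<Longrightarrow> rotate_perm n \<sigma> permutes {1..n}"
  unfolding rotate_perm_def by (intro permutes_compose flip_in_permutes)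

definition rotate_cell :: "nat \<times> nat \<Rightarrow> nat \<times> nat" where
  "rotate_cell = (\<lambda>(x, y). (2 - x, 2 - y))"

lemma in_strip_flip_in:
  assumes "x \<le> 2" "1 \<le> a" "a < b" "b \<le> n" "l \<in> {1..n}"
  shows "in_strip n (flip_in n b) (flip_in n a) (2 - x) (flip_in n l) \<longleftrightarrow> in_strip n a b x l"
proof -
  consider "x = 0" | "x = 1" | "x = 2" using assms(1) by linarith
  then show ?thesis
    using assms(2-) by cases (auto simp: in_strip_def flip_in_def numeral_2_eq_2)
qed

lemma in_strip_bounds:
  assumes "in_strip n a b x l" "x \<le> 2" "a \<le> n" "b \<le> n"
  shows "l \<in> {1..n}"
proof -
  consider "x = 0" | "x = 1" | "x = 2" using assms(2) by linarith
  then show ?thesis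
    using assms by cases (auto simp: in_strip_def numeral_2_eq_2)
qed

text \<open>
  A half turn exchanges the two entries of an occurrence and puts the strip \<open>2 - x\<close> in the place
  of the strip \<open>x\<close>, for columns as for rows.
\<close>

lemma mesh12_occurrence_rotate:
  assumes \<sigma>: "\<sigma> permutes {1..n}" and R: "R \<subseteq> {..2} \<times> {..2}"
    and occ: "mesh12_occurrence R n \<sigma> i1 i2"
  shows "mesh12_occurrence (rotate_cell ` R) n (rotate_perm n \<sigma>) (flip_in n i2) (flip_in n i1)"
proof -
  have i: "1 \<le> i1" "i1 < i2" "i2 \<le> n" "\<sigma> i1 < \<sigma> i2"
    and no: "\<And>x y l. (x, y) \<in> R \<Longrightarrow> in_strip n i1 i2 x l \<Longrightarrow> \<not> in_strip n (\<sigma> i1) (\<sigma> i2) y (\<sigma> l)"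
    using occ unfolding mesh12_occurrence_iff by blast+
  have v: "1 \<le> \<sigma> i1" "\<sigma> i2 \<le> n"
    using i permutes_in_image[OF \<sigma>, of i1] permutes_in_image[OF \<sigma>, of i2] by auto
  have flip: "1 \<le> flip_in n b" "flip_in n b < flip_in n a" "flip_in n a \<le> n"
    if "1 \<le> a" "a < b" "b \<le> n" for a b
    using that by (auto simp: flip_in_def)
  have rot: "rotate_perm n \<sigma> l = flip_in n (\<sigma> (flip_in n l))" for l
    by (simp add: rotate_perm_def)
  have empty: "\<not> in_strip n (flip_in n (\<sigma> i2)) (flip_in n (\<sigma> i1)) y' (flip_in n (\<sigma> (flip_in n l)))"
    if xy': "(x', y') \<in> rotate_cell ` R" and l: "in_strip n (flip_in n i2) (flip_in n i1) x' l"
    for x' y' l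
  proof -
    obtain x y where xy: "(x, y) \<in> R" "x' = 2 - x" "y' = 2 - y"
      using xy' by (auto simp: rotate_cell_def)
    then have le: "x \<le> 2" "y \<le> 2" using R by auto
    have "l \<in> {1..n}"
      using in_strip_bounds[OF l] flip[OF i(1-3)] xy(2) by simp
    then have m: "flip_in n l \<in> {1..n}" by (auto simp: flip_in_def)
    then have \<sigma>m: "\<sigma> (flip_in n l) \<in> {1..n}" by (simp only: permutes_in_image[OF \<sigma>])
    have "in_strip n i1 i2 x (flip_in n l)"
      using l in_strip_flip_in[OF le(1) i(1-3) m] xy(2) by simp
    then have "\<not> in_strip n (\<sigma> i1) (\<sigma> i2) y (\<sigma> (flip_in n l))"
      by (rule no[OF xy(1)])
    then show ?thesis
      using in_strip_flip_in[OF le(2) v(1) i(4) v(2) \<sigma>m] xy(3) by simp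
  qed
  show ?thesis
    unfolding mesh12_occurrence_iff rot flip_in_flip_in
    using flip[OF i(1-3)] flip(2)[OF v(1) i(4) v(2)] empty by blast
qed

lemma mesh12_gf_rotate:
  assumes R: "R \<subseteq> {..2} \<times> {..2}"
  shows "mesh12_gf (rotate_cell ` R) = mesh12_gf R"
proof (rule mesh12_gf_eqI)
  show "bij_betw (rotate_perm n) {\<sigma>. \<sigma> permutes {1..n}} {\<sigma>. \<sigma> permutes {1..n}}" for n
    by (rule bij_betw_byWitness[where f' = "rotate_perm n"])
      (auto simp del: One_nat_def intro: rotate_perm_permutes)
next
  fix n and \<sigma> :: "nat \<Rightarrow> nat" assume \<sigma>: "\<sigma> permutes {1..n}"
  have R': "rotate_cell ` R \<subseteq> {..2} \<times> {..2}" by (auto simp: rotate_cell_def)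
  have RR: "rotate_cell ` rotate_cell ` R = R"
    using R by (force simp: rotate_cell_def image_image)
  let ?f = "\<lambda>(i1, i2). (flip_in n i2, flip_in n i1)"
  have "bij_betw ?f (mesh12_occurrences R n \<sigma>)
     (mesh12_occurrences (rotate_cell ` R) n (rotate_perm n \<sigma>))"
    using mesh12_occurrence_rotate[OF \<sigma> R]
      mesh12_occurrence_rotate[OF rotate_perm_permutes[OF \<sigma>] R', unfolded RR]
    by (intro bij_betw_byWitness[where f' = ?f]) (auto simp: mesh12_occurrences_def)
  then show "card (mesh12_occurrences (rotate_cell ` R) n (rotate_perm n \<sigma>)) =
      card (mesh12_occurrences R n \<sigma>)"
    by (rule bij_betw_same_card[symmetric])
qed

theorem theorem1p7:
  fixes R :: "(nat \<times> nat) set"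
  assumes "R \<in> {
    {(0,2),(1,2),(2,2),(1,1),(0,0)},
    {(0,2),(2,2),(0,1),(1,1),(0,0)},
    {(2,2),(1,1),(2,1),(0,0),(2,0)},
    {(2,2),(1,1),(0,0),(1,0),(2,0)},
    {(0,2),(1,2),(0,1),(2,1),(0,0)},
    {(0,2),(1,2),(2,2),(0,1),(1,0)},
    {(2,2),(0,1),(2,1),(1,0),(2,0)},
    {(1,2),(2,1),(0,0),(1,0),(2,0)}}"
  shows "mesh12_avoid_gf R = subst_q0 (mesh12_gf R) \<and>
    (\<forall>n\<ge>1. fps_nth (mesh12_gf R) n =
       (\<Sum>m=0..n-1. fps_const (fact (n-1) / fact m) * T_poly m))"
proof (intro conjI allI impI)
  show "mesh12_avoid_gf R = subst_q0 (mesh12_gf R)"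
    by (rule fps_ext) (simp add: mesh12_avoid_gf_def subst_q0_def mesh12_gf_def)
next
  let ?S = "{(1,2),(2,1),(0,0),(1,0),(2,0)} :: (nat \<times> nat) set"
  let ?D = "{(2,2),(1,1),(0,0),(1,0),(2,0)} :: (nat \<times> nat) set"
  fix n :: nat assume "n \<ge> 1"
  then obtain k where n: "n = Suc k" by (cases n) auto
  \<comment> \<open>Each of the remaining six shadings is the image of \<open>?S\<close> or \<open>?D\<close> under a symmetry.\<close>
  have orbits:
    "{(0,2),(1,2),(2,2),(1,1),(0,0)} = rotate_cell ` ?D"
    "{(0,2),(2,2),(0,1),(1,1),(0,0)} = prod.swap ` ?D"
    "{(2,2),(1,1),(2,1),(0,0),(2,0)} = rotate_cell ` prod.swap ` ?D"
    "{(0,2),(1,2),(0,1),(2,1),(0,0)} = prod.swap ` ?S"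
    "{(0,2),(1,2),(2,2),(0,1),(1,0)} = rotate_cell ` ?S"
    "{(2,2),(0,1),(2,1),(1,0),(2,0)} = rotate_cell ` prod.swap ` ?S"
    by (auto simp: rotate_cell_def)
  have "R \<in> (\<Union>B\<in>{?S, ?D}. {B, prod.swap ` B, rotate_cell ` B, rotate_cell ` prod.swap ` B})"
    using assms unfolding orbits UN_insert UN_empty Un_iff insert_iff empty_iff by argo
  then obtain B where B: "B \<in> {?S, ?D}"
    and R: "R \<in> {B, prod.swap ` B, rotate_cell ` B, rotate_cell ` prod.swap ` B}" by blast
  have "B \<subseteq> {..2} \<times> {..2}" "prod.swap ` B \<subseteq> {..2} \<times> {..2}" using B by auto
  then have "mesh12_gf R = mesh12_gf B"
    using R mesh12_gf_swap[of B] mesh12_gf_rotate[of B] mesh12_gf_rotate[of "prod.swap ` B"]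
    by (elim insertE emptyE) (simp_all only:)
  then show "fps_nth (mesh12_gf R) n = (\<Sum>m=0..n-1. fps_const (fact (n-1) / fact m) * T_poly m)"
    using mesh12_gf_nth_bottom_row[of B k] B n by (simp add: atLeast0AtMost)
qed

end
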